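(* Let $V$ be the Volterra integration operator on the complex Hilbert space $L^2(0;1)$, $(Vf)(x)=\int_0^x f(t)\,dt$, and let $E(V)=\{f\in L^2(0;1): \|Vf\|=\|V^*f\|\}$. Let $u_1(x)=\sqrt{2+\sqrt3}-\sqrt6\,x$ and $u_2(x)=\sqrt6\,x-\sqrt{2-\sqrt3}$. Then $$E(V)=\{f\in L^2(0;1): |\langle f,u_1\rangle|=|\langle f,u_2\rangle|\}=\bigcup_{\varphi\in[0;2\pi)}L_\varphi,$$ where, for each $\varphi\in[0;2\pi)$, $L_\varphi$ is the orthogonal complement in $L^2(0;1)$ of the one-dimensional subspace spanned by $u_1-e^{i\varphi}u_2$.
   Context: The inner product on $L^2(0;1)$ is $\langle f,g\rangle=\int_0^1 f(t)\overline{g(t)}\,dt$, with corresponding norm $\|\cdot\|$, and $V^*$ is the Hilbert space adjoint of $V$. *)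

theory Defs
  imports "HOL-Analysis.Analysis"
begin

section \<open>The complex Hilbert space \<open>L\<^sup>2(0;1)\<close>\<close>

abbreviation unit_measure :: "real measure"
  where "unit_measure \<equiv> lebesgue_on {0<..<1}"

definition square_integrable :: "(real \<Rightarrow> complex) \<Rightarrow> bool"
  where "square_integrable f \<longleftrightarrow>
    f \<in> borel_measurable unit_measure \<and> integrable unit_measure (\<lambda>t. (cmod (f t))\<^sup>2)"

definition ae_eq :: "(real \<Rightarrow> complex) \<Rightarrow> (real \<Rightarrow> complex) \<Rightarrow> bool"
  where "ae_eq f g \<longleftrightarrow> square_integrable f \<and> square_integrable g \<and>
    (AE t in unit_measure. f t = g t)"

lemma finite_unit_measure: "finite_measure unit_measure"
  by (rule finite_measure_lebesgue_on) auto

lemma borel_measurable_ident_unit: "(\<lambda>x. x) \<in> unit_measure \<rightarrow>\<^sub>M borel"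
  by (intro measurable_restrict_space1 measurable_completion) simp

lemma borel_measurable_cnj:
  "f \<in> borel_measurable M \<Longrightarrow> (\<lambda>x. cnj (f x)) \<in> borel_measurable M"
  by (rule measurable_compose[OF _ borel_measurable_continuous_onI])
    (auto intro: continuous_intros)

lemma square_integrable_const: "square_integrable (\<lambda>_. c)"
  unfolding square_integrable_def
  by (auto intro: finite_measure.integrable_const[OF finite_unit_measure])

lemma square_integrable_add:
  assumes "square_integrable f" "square_integrable g"
  shows "square_integrable (\<lambda>t. f t + g t)"
proof -
  have m [measurable]: "f \<in> borel_measurable unit_measure" "g \<in> borel_measurable unit_measure"
    and i: "integrable unit_measure (\<lambda>t. (cmod (f t))\<^sup>2)"
      "integrable unit_measure (\<lambda>t. (cmod (g t))\<^sup>2)"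
    using assms by (auto simp: square_integrable_def)
  have le: "(cmod (a + b))\<^sup>2 \<le> 2 * (cmod a)\<^sup>2 + 2 * (cmod b)\<^sup>2" for a b
  proof -
    have "(cmod (a + b))\<^sup>2 \<le> (cmod a + cmod b)\<^sup>2"
      by (intro power_mono norm_triangle_ineq) auto
    also have "\<dots> \<le> 2 * (cmod a)\<^sup>2 + 2 * (cmod b)\<^sup>2"
      using sum_squares_bound[of "cmod a" "cmod b"] by (simp add: power2_sum)
    finally show ?thesis .
  qed
  have "integrable unit_measure (\<lambda>t. (cmod (f t + g t))\<^sup>2)"
  proof (rule Bochner_Integration.integrable_bound)
    show "integrable unit_measure (\<lambda>t. 2 * (cmod (f t))\<^sup>2 + 2 * (cmod (g t))\<^sup>2)"
      by (intro Bochner_Integration.integrable_add integrable_mult_right i)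
    show "(\<lambda>t. (cmod (f t + g t))\<^sup>2) \<in> borel_measurable unit_measure"
      by measurable
    show "AE t in unit_measure. norm ((cmod (f t + g t))\<^sup>2)
        \<le> norm (2 * (cmod (f t))\<^sup>2 + 2 * (cmod (g t))\<^sup>2)"
      using le by (intro AE_I2) simp
  qed
  then show ?thesis
    by (simp add: square_integrable_def m borel_measurable_add)
qed

lemma square_integrable_mult:
  assumes "square_integrable f"
  shows "square_integrable (\<lambda>t. c * f t)"
  using assms by (auto simp: square_integrable_def norm_mult power_mult_distrib)

lemma square_integrable_uminus:
  assumes "square_integrable f"
  shows "square_integrable (\<lambda>t. - f t)"
  using square_integrable_mult[OF assms, of "-1"] by simp

lemma square_integrable_minus:
  assumes "square_integrable f" "square_integrable g"
  shows "square_integrable (\<lambda>t. f t - g t)"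
  using square_integrable_add[OF assms(1) square_integrable_uminus[OF assms(2)]] by simp

lemma square_integrable_bounded:
  assumes "f \<in> borel_measurable unit_measure" "\<And>t. t \<in> {0<..<1} \<Longrightarrow> cmod (f t) \<le> B"
  shows "square_integrable f"
proof -
  have "integrable unit_measure (\<lambda>t. (cmod (f t))\<^sup>2)"
  proof (rule finite_measure.integrable_const_bound[OF finite_unit_measure, of _ "B\<^sup>2"])
    show "AE t in unit_measure. norm ((cmod (f t))\<^sup>2) \<le> B\<^sup>2"
      using assms(2) by (intro AE_I2) (simp add: power_mono)
    show "(\<lambda>t. (cmod (f t))\<^sup>2) \<in> borel_measurable unit_measure"
      using assms(1) by measurable
  qed
  then show ?thesis using assms by (simp add: square_integrable_def)
qed

lemma integrable_of_square_integrable: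
  assumes "square_integrable f"
  shows "integrable unit_measure f"
proof (rule Bochner_Integration.integrable_bound[of _ "\<lambda>t. 1 + (cmod (f t))\<^sup>2"])
  show "integrable unit_measure (\<lambda>t. 1 + (cmod (f t))\<^sup>2)"
    using assms
    by (intro Bochner_Integration.integrable_add finite_measure.integrable_const[OF finite_unit_measure])
      (simp add: square_integrable_def)
  have "x \<le> 1 + x\<^sup>2" for x :: real
    using zero_le_power2[of "x - 1/2"] by (simp add: power2_eq_square algebra_simps)
  then show "AE t in unit_measure. cmod (f t) \<le> norm (1 + (cmod (f t))\<^sup>2)"
    by (auto intro!: AE_I2)
qed (use assms in \<open>auto simp: square_integrable_def\<close>)

lemma ae_eq_measurable:
  "ae_eq f g \<Longrightarrow> f \<in> borel_measurable unit_measure \<and> g \<in> borel_measurable unit_measure"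
  by (auto simp: ae_eq_def square_integrable_def)

lemma part_equivp_ae_eq: "part_equivp ae_eq"
proof (rule part_equivpI)
  show "\<exists>f. ae_eq f f"
    using square_integrable_const[of 0] by (auto simp: ae_eq_def)
  show "symp ae_eq"
    by (rule sympI) (simp add: ae_eq_def eq_commute)
  show "transp ae_eq"
    by (rule transpI) (auto simp: ae_eq_def elim: eventually_elim2)
qed

text \<open>Representatives are total functions on the reals, but almost-everywhere equality is taken on
  the open unit interval only, so their values elsewhere are irrelevant.\<close>

quotient_type l2 = "real \<Rightarrow> complex" / partial: ae_eq
  by (rule part_equivp_ae_eq)

instantiation l2 :: ab_group_add
begin

lift_definition zero_l2 :: l2 is "\<lambda>_. 0"
  by (simp add: ae_eq_def square_integrable_const)

lift_definition plus_l2 :: "l2 \<Rightarrow> l2 \<Rightarrow> l2" is "\<lambda>f g t. f t + g t"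
  unfolding ae_eq_def by (auto intro: square_integrable_add elim: eventually_elim2)

lift_definition uminus_l2 :: "l2 \<Rightarrow> l2" is "\<lambda>f t. - f t"
  unfolding ae_eq_def by (auto intro: square_integrable_uminus elim: eventually_mono)

lift_definition minus_l2 :: "l2 \<Rightarrow> l2 \<Rightarrow> l2" is "\<lambda>f g t. f t - g t"
  unfolding ae_eq_def by (auto intro: square_integrable_minus elim: eventually_elim2)

instance
proof
  fix a b c :: l2
  show "a + b + c = a + (b + c)"
    by transfer (auto simp: ae_eq_def add.assoc intro!: square_integrable_add)
  show "a + b = b + a"
    by transfer (auto simp: ae_eq_def add.commute intro!: square_integrable_add)
  show "0 + a = a"
    by transfer (auto simp: ae_eq_def)
  show "- a + a = 0"
    by transfer (auto simp: ae_eq_def intro!: square_integrable_const)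
  show "a - b = a + - b"
    by transfer (auto simp: ae_eq_def
        intro!: square_integrable_add square_integrable_uminus square_integrable_minus)
qed

end

lift_definition scaleC :: "complex \<Rightarrow> l2 \<Rightarrow> l2"  (infixr \<open>*\<^sub>C\<close> 75) is "\<lambda>c f t. c * f t"
  unfolding ae_eq_def by (auto intro: square_integrable_mult elim: eventually_mono)

interpretation l2: vector_space scaleC
proof
  fix a b :: complex and x y :: l2
  show "a *\<^sub>C (x + y) = a *\<^sub>C x + a *\<^sub>C y"
    by transfer (auto simp: ae_eq_def distrib_left
        intro!: square_integrable_add square_integrable_mult)
  show "(a + b) *\<^sub>C x = a *\<^sub>C x + b *\<^sub>C x"
    by transfer (auto simp: ae_eq_def distrib_right
        intro!: square_integrable_add square_integrable_mult)
  show "a *\<^sub>C b *\<^sub>C x = (a * b) *\<^sub>C x"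
    by transfer (auto simp: ae_eq_def mult.assoc intro!: square_integrable_mult)
  show "1 *\<^sub>C x = x"
    by transfer (auto simp: ae_eq_def)
qed

lift_definition inner_l2 :: "l2 \<Rightarrow> l2 \<Rightarrow> complex"  (\<open>\<langle>_, _\<rangle>\<close>)
  is "\<lambda>f g. LINT t|unit_measure. f t * cnj (g t)"
proof -
  fix f f' g g' assume "ae_eq f f'" "ae_eq g g'"
  note [measurable] = ae_eq_measurable[OF this(1), THEN conjunct1]
    ae_eq_measurable[OF this(1), THEN conjunct2]
    ae_eq_measurable[OF this(2), THEN conjunct1]
    ae_eq_measurable[OF this(2), THEN conjunct2]
  from \<open>ae_eq f f'\<close> \<open>ae_eq g g'\<close>
  have "AE t in unit_measure. f t * cnj (g t) = f' t * cnj (g' t)"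
    unfolding ae_eq_def by (auto elim: eventually_elim2)
  then show "(LINT t|unit_measure. f t * cnj (g t)) = (LINT t|unit_measure. f' t * cnj (g' t))"
    by (intro integral_cong_AE) (auto intro!: borel_measurable_times borel_measurable_cnj)
qed

definition norm_l2 :: "l2 \<Rightarrow> real"  (\<open>\<parallel>_\<parallel>\<close>)
  where "\<parallel>f\<parallel> = sqrt (Re \<langle>f, f\<rangle>)"

text \<open>Complex versions of the library's \<^const>\<open>adjoint\<close> and
  \<^const>\<open>orthogonal_comp\<close>, which are based on the real inner product.
  The adjoint is unique when it exists, since the inner product is definite on \<open>l2\<close>.\<close>

definition hilbert_adjoint :: "(l2 \<Rightarrow> l2) \<Rightarrow> l2 \<Rightarrow> l2"
  where "hilbert_adjoint T = (THE S. \<forall>f g. \<langle>T f, g\<rangle> = \<langle>f, S g\<rangle>)"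

definition orthogonal_complement :: "l2 set \<Rightarrow> l2 set"
  where "orthogonal_complement S = {f. \<forall>g\<in>S. \<langle>f, g\<rangle> = 0}"


section \<open>The Volterra operator\<close>

lemma set_integral_unit_measure:
  fixes f :: "real \<Rightarrow> complex"
  assumes "x \<in> {0<..<1}"
  shows "(LINT t:{0<..<x}|lebesgue. f t) = (LINT t|unit_measure. indicator {0<..<x} t *\<^sub>R f t)"
  unfolding set_lebesgue_integral_def
  by (subst integral_restrict_space)
    (use assms in \<open>auto simp: set_lebesgue_integral_def indicator_def intro!: Bochner_Integration.integral_cong\<close>)

lemma square_integrable_volterra:
  assumes "square_integrable f"
  shows "square_integrable (\<lambda>x. LINT t:{0<..<x}|lebesgue. f t)"
proof (rule square_integrable_bounded)
  interpret finite_measure unit_measure by (rule finite_unit_measure)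
  have [measurable]: "f \<in> borel_measurable unit_measure"
    using assms by (simp add: square_integrable_def)
  note borel_measurable_ident_unit [measurable]
  have "(\<lambda>x. LINT t|unit_measure. (if 0 < t \<and> t < x then f t else 0)) \<in> borel_measurable unit_measure"
    by measurable
  also have "?this \<longleftrightarrow> (\<lambda>x. LINT t:{0<..<x}|lebesgue. f t) \<in> borel_measurable unit_measure"
    by (intro measurable_cong)
      (auto simp: set_integral_unit_measure indicator_def intro!: Bochner_Integration.integral_cong)
  finally show "(\<lambda>x. LINT t:{0<..<x}|lebesgue. f t) \<in> borel_measurable unit_measure" .
  fix x :: real assume x: "x \<in> {0<..<1}"
  have i: "integrable unit_measure (\<lambda>t. cmod (f t))"
    using integrable_of_square_integrable[OF assms] by simp
  show "cmod (LINT t:{0<..<x}|lebesgue. f t) \<le> (LINT t|unit_measure. cmod (f t))"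
    unfolding set_integral_unit_measure[OF x]
    by (rule order_trans[OF integral_norm_bound], rule integral_mono_AE'[OF i])
      (auto simp: indicator_def)
qed

lift_definition volterra :: "l2 \<Rightarrow> l2"
  is "\<lambda>f x. LINT t:{0<..<x}|lebesgue. f t"
proof -
  fix f g assume fg: "ae_eq f g"
  note [measurable] = ae_eq_measurable[OF fg, THEN conjunct1] ae_eq_measurable[OF fg, THEN conjunct2]
  have "(LINT t:{0<..<x}|lebesgue. f t) = (LINT t:{0<..<x}|lebesgue. g t)" if x: "x \<in> {0<..<1}" for x
  proof -
    have [measurable]: "{0<..<x} \<in> sets unit_measure"
      using x by (auto simp: sets_restrict_space image_iff intro!: bexI[of _ "{0<..<x}"])
    show ?thesis
      unfolding set_integral_unit_measure[OF x]
      by (rule integral_cong_AE) (use fg in \<open>auto simp: ae_eq_def elim: eventually_mono\<close>)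
  qed
  then show "ae_eq (\<lambda>x. LINT t:{0<..<x}|lebesgue. f t) (\<lambda>x. LINT t:{0<..<x}|lebesgue. g t)"
    using fg square_integrable_volterra by (auto simp: ae_eq_def intro!: AE_I2)
qed

definition E_set :: "(l2 \<Rightarrow> l2) \<Rightarrow> l2 set"
  where "E_set T = {f. \<parallel>T f\<parallel> = \<parallel>hilbert_adjoint T f\<parallel>}"

lemma square_integrable_affine:
  fixes a b :: real
  shows "square_integrable (\<lambda>x. complex_of_real (a + b * x))"
proof (rule square_integrable_bounded)
  note borel_measurable_ident_unit [measurable]
  show "(\<lambda>x. complex_of_real (a + b * x)) \<in> borel_measurable unit_measure"
    by measurable
  fix t :: real assume "t \<in> {0<..<1}"
  then have "\<bar>b * t\<bar> \<le> \<bar>b\<bar>" by (auto simp: abs_mult mult_left_le)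
  then show "cmod (complex_of_real (a + b * t)) \<le> \<bar>a\<bar> + \<bar>b\<bar>"
    unfolding norm_of_real by linarith
qed

lift_definition u1 :: l2 is "\<lambda>x. complex_of_real (sqrt (2 + sqrt 3) - sqrt 6 * x)"
  using square_integrable_affine[of "sqrt (2 + sqrt 3)" "- sqrt 6"] by (simp add: ae_eq_def)

lift_definition u2 :: l2 is "\<lambda>x. complex_of_real (sqrt 6 * x - sqrt (2 - sqrt 3))"
  using square_integrable_affine[of "- sqrt (2 - sqrt 3)" "sqrt 6"] by (simp add: ae_eq_def)

definition line_phi :: "real \<Rightarrow> l2 set"
  where "line_phi \<phi> = l2.span {u1 - exp (\<i> * of_real \<phi>) *\<^sub>C u2}"

definition L_phi :: "real \<Rightarrow> l2 set"
  where "L_phi \<phi> = orthogonal_complement (line_phi \<phi>)"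

end

theory Submission
  imports Defs
begin

text \<open>
  Write \<open>1\<close> for the constant function (\<open>one_l2\<close>), \<open>c = \<langle>f, 1\<rangle>\<close> and \<open>m = \<langle>f, V 1\<rangle>\<close>, where
  \<open>(V 1)(x) = x\<close>. Everything rests on integration by parts,
  \<open>\<langle>V f, g\<rangle> + \<langle>f, V g\<rangle> = \<langle>f, 1\<rangle> * cnj \<langle>g, 1\<rangle>\<close> (\<open>volterra_by_parts\<close>). It says that
  \<open>V\<^sup>* f = c 1 - V f\<close>, and it gives \<open>\<langle>V f, 1\<rangle> = c - m\<close>. Expanding the square,
  \<open>\<parallel>V\<^sup>* f\<parallel>\<^sup>2 = \<bar>c\<bar>\<^sup>2 - 2 Re (c * cnj (c - m)) + \<parallel>V f\<parallel>\<^sup>2\<close>, so that \<open>\<parallel>V f\<parallel> = \<parallel>V\<^sup>* f\<parallel>\<close> becomes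
  the equation \<open>\<bar>c\<bar>\<^sup>2 = 2 Re (c * cnj m)\<close> in the two numbers \<open>c\<close> and \<open>m\<close> alone.

  Since \<open>u1\<close> and \<open>u2\<close> are combinations of \<open>1\<close> and \<open>V 1\<close>, the difference
  \<open>\<bar>\<langle>f, u1\<rangle>\<bar>\<^sup>2 - \<bar>\<langle>f, u2\<rangle>\<bar>\<^sup>2\<close> is also a quadratic form in \<open>c\<close> and \<open>m\<close>, and their coefficients
  make it \<open>2 * sqrt 3\<close> times \<open>\<bar>c\<bar>\<^sup>2 - 2 Re (c * cnj m)\<close>
  (\<open>cmod_inner_u_eq_iff\<close>). Finally, two complex numbers have equal modulus exactly when they
  differ by a phase, which splits this cone into the hyperplanes orthogonal to
  \<open>u1 - exp (\<i> * \<phi>) u2\<close>. These vectors are nonzero because \<open>1\<close> and \<open>V 1\<close> are linearly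
  independent.
\<close>

section \<open>The inner product\<close>

lemma integrable_mult_cnj:
  assumes "square_integrable f" "square_integrable g"
  shows "integrable unit_measure (\<lambda>t. f t * cnj (g t))"
proof (rule Bochner_Integration.integrable_bound)
  have [measurable]: "f \<in> borel_measurable unit_measure" "g \<in> borel_measurable unit_measure"
    using assms by (auto simp: square_integrable_def)
  note borel_measurable_cnj [measurable]
  show "integrable unit_measure (\<lambda>t. (cmod (f t))\<^sup>2 + (cmod (g t))\<^sup>2)"
    using assms by (intro Bochner_Integration.integrable_add) (auto simp: square_integrable_def)
  show "(\<lambda>t. f t * cnj (g t)) \<in> borel_measurable unit_measure"
    by measurable
  have "x * y \<le> x\<^sup>2 + y\<^sup>2" if "x \<ge> 0" "y \<ge> 0" for x y :: real
  proof -
    have "x * y \<le> 2 * x * y" using that by simp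
    also have "\<dots> \<le> x\<^sup>2 + y\<^sup>2" by (rule sum_squares_bound)
    finally show ?thesis .
  qed
  then show "AE t in unit_measure. norm (f t * cnj (g t)) \<le> norm ((cmod (f t))\<^sup>2 + (cmod (g t))\<^sup>2)"
    by (intro AE_I2) (simp add: norm_mult)
qed

lemma inner_l2_add_left: "\<langle>f + g, h\<rangle> = \<langle>f, h\<rangle> + \<langle>g, h\<rangle>"
  by transfer (simp add: ae_eq_def distrib_right integrable_mult_cnj)

lemma inner_l2_diff_left: "\<langle>f - g, h\<rangle> = \<langle>f, h\<rangle> - \<langle>g, h\<rangle>"
  using inner_l2_add_left[of "f - g" g h] by simp

lemma inner_l2_scaleC_left: "\<langle>c *\<^sub>C f, h\<rangle> = c * \<langle>f, h\<rangle>"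
  by transfer (simp add: mult.assoc)

lemma inner_l2_commute: "\<langle>f, g\<rangle> = cnj \<langle>g, f\<rangle>"
  by transfer (simp add: mult.commute flip: Bochner_Integration.integral_cnj)

lemma inner_l2_diff_right: "\<langle>h, f - g\<rangle> = \<langle>h, f\<rangle> - \<langle>h, g\<rangle>"
  by (metis inner_l2_commute inner_l2_diff_left complex_cnj_diff)

lemma inner_l2_scaleC_right: "\<langle>h, c *\<^sub>C f\<rangle> = cnj c * \<langle>h, f\<rangle>"
  by (metis inner_l2_commute inner_l2_scaleC_left complex_cnj_mult)

lemmas inner_l2_simps = inner_l2_diff_left inner_l2_scaleC_left
  inner_l2_diff_right inner_l2_scaleC_right

lemma inner_l2_definite:
  assumes "\<langle>f, f\<rangle> = 0"
  shows "f = 0"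
  using assms
proof transfer
  fix f assume f: "ae_eq f f" and eq: "(LINT t|unit_measure. f t * cnj (f t)) = 0"
  have i: "integrable unit_measure (\<lambda>t. (cmod (f t))\<^sup>2)"
    using f by (simp add: ae_eq_def square_integrable_def)
  have "complex_of_real (LINT t|unit_measure. (cmod (f t))\<^sup>2) = 0"
    using eq by (simp add: complex_norm_square[symmetric] integral_complex_of_real flip: of_real_power)
  then have "(LINT t|unit_measure. (cmod (f t))\<^sup>2) = 0"
    by simp
  then have "AE t in unit_measure. (cmod (f t))\<^sup>2 = 0"
    using integral_nonneg_eq_0_iff_AE[OF i] by simp
  then show "ae_eq f (\<lambda>_. 0)"
    using f by (auto simp: ae_eq_def square_integrable_const)
qed

lemma hilbert_adjoint_eqI:
  assumes "\<And>f g. \<langle>T f, g\<rangle> = \<langle>f, S g\<rangle>"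
  shows "hilbert_adjoint T = S"
  unfolding hilbert_adjoint_def
proof (rule the_equality)
  fix R assume R: "\<forall>f g. \<langle>T f, g\<rangle> = \<langle>f, R g\<rangle>"
  show "R = S"
  proof
    fix g
    have "\<langle>R g - S g, R g - S g\<rangle> = 0"
      using R assms by (simp add: inner_l2_diff_right)
    then show "R g = S g"
      using inner_l2_definite by fastforce
  qed
qed (use assms in simp)

section \<open>The adjoint of the Volterra operator\<close>

lemma AE_unit_measure_neq: "AE t in unit_measure. t \<noteq> x"
proof -
  have "AE t in lebesgue. t \<noteq> x"
    by (intro AE_completion AE_lborel_singleton)
  then show ?thesis
    by (subst AE_restrict_space_iff) (auto elim: eventually_mono)
qed

text \<open>Both terms on the left are integrals of the same function \<open>f x * cnj (g t)\<close>, one over the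
  triangle \<open>x < t\<close> of the unit square and the other over \<open>t < x\<close>. The diagonal between them
  is negligible, so the sum is the integral over the whole square, which is a product. This argument
  by Fubini's theorem avoids differentiating the indefinite integrals of functions that are merely
  integrable.\<close>

lemma volterra_by_parts_integral:
  assumes f: "integrable unit_measure f" and g: "integrable unit_measure g"
  shows "(LINT x|unit_measure. (LINT t:{0<..<x}|lebesgue. f t) * cnj (g x))
       + (LINT x|unit_measure. f x * cnj (LINT t:{0<..<x}|lebesgue. g t))
       = (LINT x|unit_measure. f x) * cnj (LINT x|unit_measure. g x)"
proof -
  interpret finite_measure unit_measure by (rule finite_unit_measure)
  interpret P: pair_sigma_finite unit_measure unit_measure ..
  define h where "h x t = f x * cnj (g t)" for x t
  define lo where "lo x t = (if t < x then h x t else 0)" for x t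
  define up where "up x t = (if x < t then h x t else 0)" for x t
  have [measurable]: "f \<in> borel_measurable unit_measure" "g \<in> borel_measurable unit_measure"
    using f g by auto
  note borel_measurable_ident_unit [measurable] borel_measurable_cnj [measurable]
  have [measurable]: "(\<lambda>p. h (fst p) (snd p)) \<in> borel_measurable (unit_measure \<Otimes>\<^sub>M unit_measure)"
    unfolding h_def by measurable
  have h: "integrable (unit_measure \<Otimes>\<^sub>M unit_measure) (\<lambda>p. h (fst p) (snd p))"
    using f g by (intro P.Fubini_integrable) (auto simp: h_def norm_mult)
  have [measurable]: "(\<lambda>p. lo (fst p) (snd p)) \<in> borel_measurable (unit_measure \<Otimes>\<^sub>M unit_measure)"
      "(\<lambda>p. up (fst p) (snd p)) \<in> borel_measurable (unit_measure \<Otimes>\<^sub>M unit_measure)"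
    unfolding lo_def up_def by measurable
  have lo: "integrable (unit_measure \<Otimes>\<^sub>M unit_measure) (\<lambda>p. lo (fst p) (snd p))"
    by (rule Bochner_Integration.integrable_bound[OF h]) (auto simp: lo_def)
  have up: "integrable (unit_measure \<Otimes>\<^sub>M unit_measure) (\<lambda>p. up (fst p) (snd p))"
    by (rule Bochner_Integration.integrable_bound[OF h]) (auto simp: up_def)
  have hx: "integrable unit_measure (h x)" for x
    using g by (simp add: h_def[abs_def])
  have [measurable]: "h x \<in> borel_measurable unit_measure" for x
    using hx by auto
  have [measurable]: "lo x \<in> borel_measurable unit_measure"
      "up x \<in> borel_measurable unit_measure" for x
    unfolding lo_def up_def by measurable
  have lox: "integrable unit_measure (lo x)" for x
    by (rule Bochner_Integration.integrable_bound[OF hx[of x]]) (auto simp: lo_def)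
  have upx: "integrable unit_measure (up x)" for x
    by (rule Bochner_Integration.integrable_bound[OF hx[of x]]) (auto simp: up_def)
  have "(LINT x|unit_measure. (LINT t:{0<..<x}|lebesgue. f t) * cnj (g x))
      = (LINT x|unit_measure. LINT t|unit_measure. up t x)"
  proof (rule Bochner_Integration.integral_cong)
    fix x assume "x \<in> space unit_measure"
    then have x: "x \<in> {0<..<1}" by simp
    have "(LINT t:{0<..<x}|lebesgue. f t) * cnj (g x)
        = (LINT t|unit_measure. indicator {0<..<x} t *\<^sub>R f t * cnj (g x))"
      unfolding set_integral_unit_measure[OF x] integral_mult_left_zero ..
    also have "\<dots> = (LINT t|unit_measure. up t x)"
      by (rule Bochner_Integration.integral_cong) (auto simp: up_def h_def)
    finally show "(LINT t:{0<..<x}|lebesgue. f t) * cnj (g x) = (LINT t|unit_measure. up t x)" .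
  qed simp
  also have "\<dots> = (LINT x|unit_measure. LINT t|unit_measure. up x t)"
    using up by (intro P.Fubini_integral) (simp add: case_prod_beta')
  (* The first term integrates over t < x with the roles of the two variables exchanged. *)
  finally have 1: "(LINT x|unit_measure. (LINT t:{0<..<x}|lebesgue. f t) * cnj (g x))
      = (LINT x|unit_measure. LINT t|unit_measure. up x t)" .
  have 2: "(LINT x|unit_measure. f x * cnj (LINT t:{0<..<x}|lebesgue. g t))
      = (LINT x|unit_measure. LINT t|unit_measure. lo x t)"
  proof (rule Bochner_Integration.integral_cong)
    fix x assume "x \<in> space unit_measure"
    then have x: "x \<in> {0<..<1}" by simp
    have "f x * cnj (LINT t:{0<..<x}|lebesgue. g t)
        = (LINT t|unit_measure. f x * cnj (indicator {0<..<x} t *\<^sub>R g t))"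
      unfolding set_integral_unit_measure[OF x]
        integral_mult_right_zero Bochner_Integration.integral_cnj ..
    also have "\<dots> = (LINT t|unit_measure. lo x t)"
      by (rule Bochner_Integration.integral_cong) (auto simp: lo_def h_def)
    finally show "f x * cnj (LINT t:{0<..<x}|lebesgue. g t) = (LINT t|unit_measure. lo x t)" .
  qed simp
  have split: "(LINT t|unit_measure. up x t) + (LINT t|unit_measure. lo x t)
      = (LINT t|unit_measure. h x t)" for x
  proof -
    have "(LINT t|unit_measure. up x t) + (LINT t|unit_measure. lo x t)
        = (LINT t|unit_measure. up x t + lo x t)"
      by (rule Bochner_Integration.integral_add[symmetric]) (rule upx lox)+
    also have "\<dots> = (LINT t|unit_measure. h x t)"
    proof (rule integral_cong_AE)
      show "AE t in unit_measure. up x t + lo x t = h x t"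
        using AE_unit_measure_neq[of x] by eventually_elim (auto simp: up_def lo_def)
    qed (use upx[of x] lox[of x] in auto)
    finally show ?thesis .
  qed
  have "(LINT x|unit_measure. LINT t|unit_measure. up x t)
        + (LINT x|unit_measure. LINT t|unit_measure. lo x t)
      = (LINT x|unit_measure. (LINT t|unit_measure. up x t) + (LINT t|unit_measure. lo x t))"
    using P.integrable_fst'[OF up] P.integrable_fst'[OF lo] by simp
  also have "\<dots> = (LINT x|unit_measure. LINT t|unit_measure. h x t)"
    by (simp only: split)
  also have "\<dots> = (LINT x|unit_measure. f x) * cnj (LINT t|unit_measure. g t)"
    by (simp add: h_def)
  finally show ?thesis
    unfolding 1 2 .
qed

lift_definition one_l2 :: l2 is "\<lambda>_. 1"
  by (simp add: ae_eq_def square_integrable_const)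

lemma volterra_by_parts:
  "\<langle>volterra f, g\<rangle> + \<langle>f, volterra g\<rangle> = \<langle>f, one_l2\<rangle> * cnj \<langle>g, one_l2\<rangle>"
  by transfer (simp add: volterra_by_parts_integral integrable_of_square_integrable ae_eq_def)

lemma hilbert_adjoint_volterra:
  "hilbert_adjoint volterra = (\<lambda>g. \<langle>g, one_l2\<rangle> *\<^sub>C one_l2 - volterra g)"
proof (rule hilbert_adjoint_eqI)
  fix f g
  show "\<langle>volterra f, g\<rangle> = \<langle>f, \<langle>g, one_l2\<rangle> *\<^sub>C one_l2 - volterra g\<rangle>"
    using volterra_by_parts[of f g]
    by (simp add: inner_l2_simps mult.commute eq_diff_eq)
qed

section \<open>Equality of the norms\<close>

lemma inner_one_one: "\<langle>one_l2, one_l2\<rangle> = 1"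
  by transfer (simp add: measure_restrict_space)

lemma norm_volterra_eq_iff:
  "\<parallel>volterra f\<parallel> = \<parallel>hilbert_adjoint volterra f\<parallel>
    \<longleftrightarrow> (cmod \<langle>f, one_l2\<rangle>)\<^sup>2 = 2 * Re (\<langle>f, one_l2\<rangle> * cnj \<langle>f, volterra one_l2\<rangle>)"
proof -
  define c where "c = \<langle>f, one_l2\<rangle>"
  define m where "m = \<langle>f, volterra one_l2\<rangle>"
  (* By parts against the constant function, so the integral of V f need not be computed. *)
  have a: "\<langle>volterra f, one_l2\<rangle> = c - m"
    using volterra_by_parts[of f one_l2] by (simp add: c_def m_def inner_one_one eq_diff_eq)
  then have b: "\<langle>one_l2, volterra f\<rangle> = cnj c - cnj m"
    by (subst inner_l2_commute) simp
  show ?thesis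
    unfolding norm_l2_def hilbert_adjoint_volterra c_def[symmetric] m_def[symmetric]
    by (simp add: inner_l2_simps a b inner_one_one cmod_power2)
      (auto simp: algebra_simps power2_eq_square)
qed

lemma volterra_one: "ae_eq (\<lambda>x. LINT t:{0<..<x}|lebesgue. 1) (\<lambda>x. complex_of_real x)"
proof -
  have "(LINT t:{0<..<x}|lebesgue. (1::complex)) = complex_of_real x" if "x > 0" for x
    using that by (simp add: set_lebesgue_integral_def scaleR_conv_of_real)
  moreover have "square_integrable (\<lambda>x. LINT t:{0<..<x}|lebesgue. 1)"
    by (intro square_integrable_volterra square_integrable_const)
  ultimately show ?thesis
    using square_integrable_affine[of 0 1] by (auto simp: ae_eq_def intro!: AE_I2)
qed

text \<open>The products with \<open>1\<close> stay unsimplified, since transferring \<open>u1\<close> and \<open>u2\<close> to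
  functions produces \<open>one_l2\<close> and \<open>volterra one_l2\<close> in this form.\<close>

lemma ae_eq_affine_volterra_one:
  fixes a b :: real
  shows "ae_eq (\<lambda>x. complex_of_real (a + b * x))
    (\<lambda>x. complex_of_real a * 1 + complex_of_real b * (LINT t:{0<..<x}|lebesgue. 1))"
  unfolding ae_eq_def
proof (intro conjI)
  show "AE x in unit_measure. complex_of_real (a + b * x)
      = complex_of_real a * 1 + complex_of_real b * (LINT t:{0<..<x}|lebesgue. 1)"
    using volterra_one[unfolded ae_eq_def, THEN conjunct2, THEN conjunct2]
    by eventually_elim simp
qed (intro square_integrable_affine square_integrable_add square_integrable_mult
    square_integrable_volterra square_integrable_const)+

lemma u1_eq: "u1 = of_real (sqrt (2 + sqrt 3)) *\<^sub>C one_l2 - of_real (sqrt 6) *\<^sub>C volterra one_l2"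
proof transfer
  show "ae_eq (\<lambda>x. complex_of_real (sqrt (2 + sqrt 3) - sqrt 6 * x))
     (\<lambda>x. complex_of_real (sqrt (2 + sqrt 3)) * 1 -
          complex_of_real (sqrt 6) * (LINT t:{0<..<x}|lebesgue. 1))"
    using ae_eq_affine_volterra_one[of "sqrt (2 + sqrt 3)" "- sqrt 6"] by simp
qed

lemma u2_eq: "u2 = of_real (sqrt 6) *\<^sub>C volterra one_l2 - of_real (sqrt (2 - sqrt 3)) *\<^sub>C one_l2"
proof transfer
  show "ae_eq (\<lambda>x. complex_of_real (sqrt 6 * x - sqrt (2 - sqrt 3)))
     (\<lambda>x. complex_of_real (sqrt 6) * (LINT t:{0<..<x}|lebesgue. 1) -
          complex_of_real (sqrt (2 - sqrt 3)) * 1)"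
    using ae_eq_affine_volterra_one[of "- sqrt (2 - sqrt 3)" "sqrt 6"] by simp
qed

lemma sqrt3_le_2: "sqrt 3 \<le> 2"
  by (rule real_le_lsqrt) auto

lemma sqrt_coeff_diff: "sqrt (2 + sqrt 3) - sqrt (2 - sqrt 3) = sqrt 2"
proof (rule real_sqrt_unique[symmetric])
  have "sqrt (2 + sqrt 3) * sqrt (2 - sqrt 3) = 1"
    by (simp add: algebra_simps flip: real_sqrt_mult)
  then show "(sqrt (2 + sqrt 3) - sqrt (2 - sqrt 3))\<^sup>2 = 2"
    using sqrt3_le_2 by (simp add: power2_diff)
qed simp

text \<open>With \<open>u1 = a 1 - s V 1\<close> and \<open>u2 = s V 1 - b 1\<close> the terms \<open>s\<^sup>2 \<bar>m\<bar>\<^sup>2\<close> of the two squared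
  moduli cancel. What remains is \<open>(a\<^sup>2 - b\<^sup>2) \<bar>c\<bar>\<^sup>2 - 2 s (a - b) Re (c * cnj m)\<close>, and the
  coefficients satisfy \<open>a\<^sup>2 - b\<^sup>2 = s (a - b) = 2 * sqrt 3\<close>.\<close>

lemma cmod_inner_u_eq_iff:
  "cmod \<langle>f, u1\<rangle> = cmod \<langle>f, u2\<rangle>
    \<longleftrightarrow> (cmod \<langle>f, one_l2\<rangle>)\<^sup>2 = 2 * Re (\<langle>f, one_l2\<rangle> * cnj \<langle>f, volterra one_l2\<rangle>)"
proof -
  define a b s where "a = sqrt (2 + sqrt 3)" and "b = sqrt (2 - sqrt 3)" and "s = sqrt 6"
  define c where "c = \<langle>f, one_l2\<rangle>"
  define m where "m = \<langle>f, volterra one_l2\<rangle>"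
  have 1: "\<langle>f, u1\<rangle> = of_real a * c - of_real s * m"
    by (simp add: u1_eq inner_l2_simps a_def s_def c_def m_def)
  have 2: "\<langle>f, u2\<rangle> = of_real s * m - of_real b * c"
    by (simp add: u2_eq inner_l2_simps b_def s_def c_def m_def)
  have ab: "a\<^sup>2 - b\<^sup>2 = 2 * sqrt 3"
    using sqrt3_le_2 by (simp add: a_def b_def)
  have "s * (a - b) = sqrt 12"
    unfolding a_def b_def s_def sqrt_coeff_diff by (simp flip: real_sqrt_mult)
  also have "\<dots> = 2 * sqrt 3"
    using real_sqrt_mult[of 4 3] by simp
  finally have sab: "s * (a - b) = 2 * sqrt 3" .
  have "(cmod \<langle>f, u1\<rangle>)\<^sup>2 - (cmod \<langle>f, u2\<rangle>)\<^sup>2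
      = (a\<^sup>2 - b\<^sup>2) * (cmod c)\<^sup>2 - 2 * (s * (a - b)) * Re (c * cnj m)"
    unfolding 1 2 cmod_power2 by (simp add: power2_eq_square algebra_simps)
  also have "\<dots> = 2 * sqrt 3 * ((cmod c)\<^sup>2 - 2 * Re (c * cnj m))"
    unfolding ab sab by (simp add: algebra_simps)
  finally have "(cmod \<langle>f, u1\<rangle>)\<^sup>2 = (cmod \<langle>f, u2\<rangle>)\<^sup>2 \<longleftrightarrow> (cmod c)\<^sup>2 = 2 * Re (c * cnj m)"
    by auto
  then show ?thesis
    by (simp add: c_def m_def)
qed

section \<open>The hyperplanes\<close>

text \<open>The phase enters conjugated because the inner product is conjugate-linear in its second
  argument.\<close>

lemma cmod_eq_iff_phase:
  "cmod z = cmod w \<longleftrightarrow> (\<exists>\<phi>\<in>{0..<2 * pi}. z = cnj (exp (\<i> * of_real \<phi>)) * w)"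
proof
  assume eq: "cmod z = cmod w"
  show "\<exists>\<phi>\<in>{0..<2 * pi}. z = cnj (exp (\<i> * of_real \<phi>)) * w"
  proof (cases "w = 0")
    case True
    then show ?thesis using eq by (intro bexI[of _ 0]) auto
  next
    case False
    let ?\<phi> = "Arg2pi (cnj (z / w))"
    have "cmod (z / w) = 1"
      using eq False by (simp add: norm_divide)
    then have "cnj (z / w) = exp (\<i> * of_real ?\<phi>)"
      using Arg2pi_eq[of "cnj (z / w)"] by (metis complex_mod_cnj mult_1 of_real_1)
    then have "z = cnj (exp (\<i> * of_real ?\<phi>)) * w"
      using False by (metis complex_cnj_cnj nonzero_eq_divide_eq)
    then show ?thesis
      using Arg2pi_ge_0 Arg2pi_lt_2pi by (intro bexI[of _ ?\<phi>]) auto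
  qed
qed (auto simp: norm_mult)

lemma mem_L_phi_iff: "f \<in> L_phi \<phi> \<longleftrightarrow> \<langle>f, u1\<rangle> = cnj (exp (\<i> * of_real \<phi>)) * \<langle>f, u2\<rangle>"
proof -
  have "f \<in> L_phi \<phi> \<longleftrightarrow> (\<forall>k. cnj k * \<langle>f, u1 - exp (\<i> * of_real \<phi>) *\<^sub>C u2\<rangle> = 0)"
    by (auto simp: L_phi_def orthogonal_complement_def line_phi_def l2.span_singleton
        inner_l2_scaleC_right)
  also have "\<dots> \<longleftrightarrow> \<langle>f, u1 - exp (\<i> * of_real \<phi>) *\<^sub>C u2\<rangle> = 0"
    by (auto dest: spec[of _ 1])
  finally show ?thesis
    by (simp add: inner_l2_simps)
qed

lemma volterra_one_neq_const: "volterra one_l2 \<noteq> k *\<^sub>C one_l2"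
proof
  assume "volterra one_l2 = k *\<^sub>C one_l2"
  then have "ae_eq (\<lambda>x. LINT t:{0<..<x}|lebesgue. 1) (\<lambda>_. k * 1)"
    by transfer
  with volterra_one have "AE x in unit_measure. complex_of_real x = k"
    by (auto simp: ae_eq_def elim: eventually_elim2)
  then have "AE x in unit_measure. False"
    using AE_unit_measure_neq[of "Re k"] by eventually_elim auto
  then have "emeasure unit_measure (space unit_measure) = 0"
    by (simp only: trivial_limit_def ae_filter_eq_bot_iff flip: trivial_limit_def)
  then show False
    by (simp add: emeasure_restrict_space)
qed

text \<open>A relation \<open>u1 = e u2\<close> reads \<open>p 1 = q V 1\<close>. If \<open>q\<close> is nonzero then \<open>V 1\<close> would be
  constant; if \<open>q = 0\<close> then \<open>e = - 1\<close>, and \<open>u1 + u2\<close> is the constant \<open>sqrt 2\<close>, not zero.\<close>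

lemma u1_u2_nonproportional:
  shows "u1 - e *\<^sub>C u2 \<noteq> 0"
proof
  assume 0: "u1 - e *\<^sub>C u2 = 0"
  define p where "p = complex_of_real (sqrt (2 + sqrt 3)) + e * complex_of_real (sqrt (2 - sqrt 3))"
  define q where "q = (1 + e) * complex_of_real (sqrt 6)"
  have "u1 - e *\<^sub>C u2 = p *\<^sub>C one_l2 - q *\<^sub>C volterra one_l2"
    by (simp add: u1_eq u2_eq p_def q_def algebra_simps l2.scale_left_distrib
        l2.scale_right_diff_distrib)
  then have eq: "q *\<^sub>C volterra one_l2 = p *\<^sub>C one_l2"
    using 0 by simp
  show False
  proof (cases "q = 0")
    case True
    then have "e = - 1"
      by (simp add: q_def add_eq_0_iff)
    then have "p = complex_of_real (sqrt 2)"
      unfolding p_def sqrt_coeff_diff[symmetric] by simp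
    moreover have "p = 0"
    proof -
      have "\<langle>p *\<^sub>C one_l2, one_l2\<rangle> = \<langle>0 *\<^sub>C one_l2, one_l2\<rangle>"
        using eq unfolding True l2.scale_zero_left by (rule arg_cong[OF sym])
      then show ?thesis
        unfolding inner_l2_scaleC_left inner_one_one by simp
    qed
    ultimately show False by simp
  next
    case False
    then have "volterra one_l2 = (inverse q * p) *\<^sub>C one_l2"
      using arg_cong[OF eq, of "\<lambda>v. inverse q *\<^sub>C v"] by simp
    then show False
      using volterra_one_neq_const by blast
  qed
qed

theorem mainTheorem3:
  shows "E_set volterra = {f. cmod \<langle>f, u1\<rangle> = cmod \<langle>f, u2\<rangle>}
    \<and> {f. cmod \<langle>f, u1\<rangle> = cmod \<langle>f, u2\<rangle>} = (\<Union>\<phi>\<in>{0..<2 * pi}. L_phi \<phi>)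
    \<and> (\<forall>\<phi>\<in>{0..<2 * pi}. l2.dim (line_phi \<phi>) = 1)"
proof (intro conjI ballI)
  show "E_set volterra = {f. cmod \<langle>f, u1\<rangle> = cmod \<langle>f, u2\<rangle>}"
    by (simp add: E_set_def norm_volterra_eq_iff cmod_inner_u_eq_iff)
  show "{f. cmod \<langle>f, u1\<rangle> = cmod \<langle>f, u2\<rangle>} = (\<Union>\<phi>\<in>{0..<2 * pi}. L_phi \<phi>)"
    by (auto simp: cmod_eq_iff_phase mem_L_phi_iff)
  fix \<phi> :: real
  have "u1 - exp (\<i> * of_real \<phi>) *\<^sub>C u2 \<noteq> 0"
    by (rule u1_u2_nonproportional)
  then show "l2.dim (line_phi \<phi>) = 1"
    unfolding line_phi_def l2.dim_span by (subst l2.dim_eq_card_independent) auto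
qed

end
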